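(* For $d\in\mathbb N$ let $X_d=\{\,2^{2^{di}} : i\in\mathbb Z,\ 0\le i\le d\,\}\subset\mathbb C$. The family $(X_d)_{d}$ cannot be decided non-uniformly in time polylogarithmic in $d$. That is, there do not exist constants $a,b>0$ such that for every integer $d\ge 2$ there is a machine over $\mathbb C$ or a decision tree over $\mathbb C$ (which may depend on $d$) that, on every input $x\in\mathbb C$, decides whether $x\in X_d$ in time at most $a(\log d)^b$.
   Context: A decision tree over $\mathbb C$ with input $x\in\mathbb C$ is a finite rooted tree in which each internal node either performs one arithmetic operation ($+,-,\times,\div$) on two operands, each of which is the input $x$, a complex constant, or a result computed earlier on the path from the root, or is a branching node that tests whether a previously computed quantity equals $0$ and branches in two according to the answer; each leaf is labelled YES or NO. Its running time is its depth. It decides a set $S\subseteq\mathbb C$ if each $x\in S$ reaches a YES leaf and each $x\notin S$ reaches a NO leaf. A machine over $\mathbb C$ is a machine in the sense of Blum, Cucker, Shub and Smale: it may have finitely many complex constants, performs one arithmetic operation, one test for equality to zero, or one data-movement operation per step, and its running time is the number of steps. Non-uniform setting: a different machine or decision tree, with different constants, may be used for each value of $d$; the running time is measured as a function of $d$ and must be bounded for all inputs $x\in\mathbb C$. *)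

theory Defs
  imports Complex_Main
begin

section \<open>Arithmetic operations\<close>

datatype arith_op = Add | Sub | Mul | Div

text \<open>Division by zero is undefined, in contrast to the convention \<^term>\<open>x / 0 = (0 :: complex)\<close>
  of the library. A tree or a machine that divides by zero on some input decides nothing.\<close>

fun apply_op :: "arith_op \<Rightarrow> complex \<Rightarrow> complex \<Rightarrow> complex option" where
  "apply_op Add u v = Some (u + v)"
| "apply_op Sub u v = Some (u - v)"
| "apply_op Mul u v = Some (u * v)"
| "apply_op Div u v = (if v = 0 then None else Some (u / v))"

section \<open>Decision trees\<close>

text \<open>Results are numbered from 0 in the order in which they are computed on the path from the
  root, counting arithmetic nodes only. In \<open>Branch j t u\<close>, \<open>t\<close> is taken if result \<open>j\<close> is zero.\<close>

datatype tree_operand = Input | TConst complex | Result nat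

datatype dtree =
    Leaf bool
  | Compute arith_op tree_operand tree_operand dtree
  | Branch nat dtree dtree

primrec depth :: "dtree \<Rightarrow> nat" where
  "depth (Leaf b) = 0"
| "depth (Compute f p q t) = Suc (depth t)"
| "depth (Branch j t u) = Suc (max (depth t) (depth u))"

primrec wf_operand :: "nat \<Rightarrow> tree_operand \<Rightarrow> bool" where
  "wf_operand n Input = True"
| "wf_operand n (TConst c) = True"
| "wf_operand n (Result j) = (j < n)"

text \<open>\<open>wf_dtree n t\<close>: the subtree \<open>t\<close>, entered after \<open>n\<close> arithmetic nodes, refers only to
  quantities computed earlier on its path.\<close>

primrec wf_dtree :: "nat \<Rightarrow> dtree \<Rightarrow> bool" where
  "wf_dtree n (Leaf b) = True"
| "wf_dtree n (Compute f p q t) = (wf_operand n p \<and> wf_operand n q \<and> wf_dtree (Suc n) t)"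
| "wf_dtree n (Branch j t u) = (j < n \<and> wf_dtree n t \<and> wf_dtree n u)"

primrec tree_val :: "complex \<Rightarrow> complex list \<Rightarrow> tree_operand \<Rightarrow> complex" where
  "tree_val x rs Input = x"
| "tree_val x rs (TConst c) = c"
| "tree_val x rs (Result j) = rs ! j"

text \<open>The label of the leaf reached on input \<open>x\<close>, given the results \<open>rs\<close> computed so far.\<close>

primrec outcome :: "complex \<Rightarrow> dtree \<Rightarrow> complex list \<Rightarrow> bool option" where
  "outcome x (Leaf b) rs = Some b"
| "outcome x (Compute f p q t) rs =
     (case apply_op f (tree_val x rs p) (tree_val x rs q) of
        None \<Rightarrow> None
      | Some r \<Rightarrow> outcome x t (rs @ [r]))"
| "outcome x (Branch j t u) rs = (if rs ! j = 0 then outcome x t rs else outcome x u rs)"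

definition dtree_decides_in_time :: "dtree \<Rightarrow> complex set \<Rightarrow> real \<Rightarrow> bool" where
  "dtree_decides_in_time t S T \<longleftrightarrow>
     wf_dtree 0 t \<and> (\<forall>x. outcome x t [] = Some (x \<in> S)) \<and> real (depth t) \<le> T"

section \<open>Machines\<close>

text \<open>A Blum--Cucker--Shub--Smale machine: a finite flow chart acting on a bi-infinite tape of
  complex numbers. A finite list of nodes carries only finitely many constants. Cells are
  addressed relative to the current origin, and data are moved by shifting the tape.
  Control starts at node 0; the numbers in the nodes name their successors.
  In \<open>MBranch i k l\<close>, control passes to \<open>k\<close> if cell \<open>i\<close> is zero, and to \<open>l\<close> otherwise.\<close>

datatype machine_operand = Cell int | MConst complex

datatype node =
    MCompute int arith_op machine_operand machine_operand nat
  | MBranch int nat nat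
  | ShiftLeft nat
  | ShiftRight nat
  | Output

type_synonym machine = "node list"
type_synonym tape = "int \<Rightarrow> complex"
type_synonym config = "nat \<times> tape"

primrec successors :: "node \<Rightarrow> nat set" where
  "successors (MCompute i f p q k) = {k}"
| "successors (MBranch i k l) = {k, l}"
| "successors (ShiftLeft k) = {k}"
| "successors (ShiftRight k) = {k}"
| "successors Output = {}"

definition wf_machine :: "machine \<Rightarrow> bool" where
  "wf_machine M \<longleftrightarrow> M \<noteq> [] \<and> (\<forall>n\<in>set M. successors n \<subseteq> {..<length M})"

primrec machine_val :: "tape \<Rightarrow> machine_operand \<Rightarrow> complex" where
  "machine_val z (Cell i) = z i"
| "machine_val z (MConst c) = c"

text \<open>The value \<^const>\<open>None\<close> means that there is no next configuration, because of a division by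
  zero or because the machine has halted at an output node.\<close>

primrec node_step :: "node \<Rightarrow> tape \<Rightarrow> config option" where
  "node_step (MCompute i f p q k) z =
     (case apply_op f (machine_val z p) (machine_val z q) of
        None \<Rightarrow> None
      | Some r \<Rightarrow> Some (k, z(i := r)))"
| "node_step (MBranch i k l) z = Some (if z i = 0 then k else l, z)"
| "node_step (ShiftLeft k) z = Some (k, \<lambda>i. z (i + 1))"
| "node_step (ShiftRight k) z = Some (k, \<lambda>i. z (i - 1))"
| "node_step Output z = None"

primrec steps :: "machine \<Rightarrow> nat \<Rightarrow> config \<Rightarrow> config option" where
  "steps M 0 c = Some c"
| "steps M (Suc n) c = Option.bind (node_step (M ! fst c) (snd c)) (steps M n)"

text \<open>The input occupies cell 1; cell 0 holds its length, which is 1 here.\<close>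

definition input_tape :: "complex \<Rightarrow> tape" where
  "input_tape x = (\<lambda>i. if i = 0 then 1 else if i = 1 then x else 0)"

text \<open>To decide a set is to compute its characteristic function; the output is read off cell 1.\<close>

definition machine_decides_in_time :: "machine \<Rightarrow> complex set \<Rightarrow> real \<Rightarrow> bool" where
  "machine_decides_in_time M S T \<longleftrightarrow>
     wf_machine M \<and>
     (\<forall>x. \<exists>n k z. real n \<le> T \<and> steps M n (0, input_tape x) = Some (k, z) \<and>
        M ! k = Output \<and> z 1 = (if x \<in> S then 1 else 0))"

section \<open>The family of sets\<close>

definition X :: "nat \<Rightarrow> complex set" where
  "X d = {2 ^ (2 ^ (d * i)) | i :: nat. i \<le> d}"

end

theory Submission
  imports Defs "HOL-Computational_Algebra.Polynomial" "HOL-Library.FuncSet"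
    "HOL-Library.Nat_Bijection" "HOL-Real_Asymp.Real_Asymp"
begin

text \<open>Suppose that a decision tree of depth \<open>t\<close> decides \<open>X d\<close>. Follow the path of a generic input: every
  quantity computed on it is a rational function of the input \<open>x\<close>, and every test that is not
  identically zero is answered "nonzero". Let \<open>F\<close> be the product of the numerators tested and of the
  numerators of the divisors on this path. Inputs with \<open>F x \<noteq> 0\<close> all reach the same leaf, which is a
  NO leaf since \<open>X d\<close> is finite; so \<open>F\<close> is a nonzero polynomial that vanishes on \<open>X d\<close>
  (\<open>decided_finite_set_small_polynomial\<close>). Its coefficients are integer polynomials in the at most
  \<open>2 t\<close> constants on the path. They are \<^emph>\<open>small\<close>: sums of at most \<open>2 ^ D\<close> signed monomials of
  degree at most \<open>D\<close>, where \<open>D = 4 ^ t\<close> also bounds the degree of \<open>F\<close>.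

  Such an \<open>F\<close> cannot have many roots that grow too fast, by a pigeonhole form of the fact that
  \<open>q\<close> elements algebraic over a field of transcendence degree less than \<open>q\<close> are algebraically
  dependent. Let \<open>x i = 2 ^ (2 ^ (d i))\<close> for \<open>i < q\<close> be elements of \<open>X d\<close>, and consider monomials
  \<open>\<Prod>i. x i ^ e i\<close> with all exponents at most \<open>E\<close>. Reducing powers of \<open>x i\<close> by \<open>F (x i) = 0\<close> shows
  that each sum of such monomials, times a fixed power of the leading coefficient of \<open>F\<close>, is a
  combination of the at most \<open>D ^ q\<close> monomials with exponents below \<open>degree F\<close>, with small
  coefficients. For \<open>q = 4 t + 4\<close> and \<open>E = q (D + 2) D\<^sup>2\<close> there are fewer such combinations than
  sets of exponent vectors (\<open>subset_sums_of_monomials_bound\<close>, \<open>reductions_fewer_than_subsets\<close>). But if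
  \<open>E < 2 ^ d\<close>, then the monomials are distinct powers of 2, as an exponent vector is recovered from
  digits in base \<open>2 ^ d\<close>; hence different sets of them have different sums, by uniqueness of binary
  expansions (\<open>subset_sums_of_iterated_powers_inj\<close>). This forces \<open>2 ^ d \<le> E\<close> (or \<open>d + 1 < q\<close>), so the
  depth \<open>t\<close> is at least linear in \<open>d\<close> (\<open>dtree_depth_lower_bound\<close>).

  A machine that runs for at most \<open>T\<close> steps unrolls into a decision tree of depth at most \<open>2 T + 2\<close>
  (\<open>machine_to_dtree\<close>), so the same bound holds for machines up to a constant factor.\<close>

section \<open>Sums of few monomials of low degree\<close>

text \<open>Products of at most \<open>n\<close> elements of \<open>G\<close>, with repetition. There are no coefficients: when signs
  are needed, \<open>-1\<close> is taken as one of the generators.\<close>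

definition monomials :: "'a::comm_ring_1 set \<Rightarrow> nat \<Rightarrow> 'a set" where
  "monomials G n = {prod_list xs | xs. set xs \<subseteq> G \<and> length xs \<le> n}"

text \<open>Sums of at most \<open>h\<close> such monomials, which bounds degree and height of an integer polynomial
  expression in \<open>G\<close> at once. These are values in the ring, not formal expressions.\<close>

definition monomial_sums :: "'a::comm_ring_1 set \<Rightarrow> nat \<Rightarrow> nat \<Rightarrow> 'a set" where
  "monomial_sums G n h = {sum_list ys | ys. set ys \<subseteq> monomials G n \<and> length ys \<le> h}"

text \<open>The one-parameter scale used throughout: with \<open>2 ^ n\<close> terms allowed, multiplication adds the
  parameters and addition raises the parameter by one.\<close>

abbreviation small_sums :: "'a::comm_ring_1 set \<Rightarrow> nat \<Rightarrow> 'a set" where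
  "small_sums G n \<equiv> monomial_sums G n (2 ^ n)"

lemma monomials_mono:
  assumes "G \<subseteq> G'" "n \<le> n'"
  shows "monomials G n \<subseteq> monomials G' n'"
  using assms unfolding monomials_def by fastforce

lemma monomials_mult:
  assumes "u \<in> monomials G n" "v \<in> monomials G m"
  shows "u * v \<in> monomials G (n + m)"
proof -
  obtain xs ys where "u = prod_list xs" "set xs \<subseteq> G" "length xs \<le> n"
    "v = prod_list ys" "set ys \<subseteq> G" "length ys \<le> m"
    using assms unfolding monomials_def by blast
  then show ?thesis unfolding monomials_def
    by (intro CollectI exI[of _ "xs @ ys"]) auto
qed

lemma one_in_monomials: "1 \<in> monomials G n"
  unfolding monomials_def by (intro CollectI exI[of _ "[]"]) auto

lemma generator_in_monomials: "g \<in> G \<Longrightarrow> 1 \<le> n \<Longrightarrow> g \<in> monomials G n"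
  unfolding monomials_def by (intro CollectI exI[of _ "[g]"]) auto

lemma monomial_sums_mono:
  assumes "p \<in> monomial_sums G n h" "G \<subseteq> G'" "n \<le> n'" "h \<le> h'"
  shows "p \<in> monomial_sums G' n' h'"
  using assms monomials_mono[OF assms(2,3)] unfolding monomial_sums_def
  by (smt (verit, ccfv_threshold) mem_Collect_eq order_trans)

lemma zero_in_monomial_sums: "0 \<in> monomial_sums G n h"
  unfolding monomial_sums_def by (intro CollectI exI[of _ "[]"]) auto

lemma monomial_in_monomial_sums: "u \<in> monomials G n \<Longrightarrow> 1 \<le> h \<Longrightarrow> u \<in> monomial_sums G n h"
  unfolding monomial_sums_def by (intro CollectI exI[of _ "[u]"]) auto

lemma monomial_sums_add:
  assumes "p \<in> monomial_sums G n h" "q \<in> monomial_sums G n h'"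
  shows "p + q \<in> monomial_sums G n (h + h')"
proof -
  obtain xs ys where "p = sum_list xs" "set xs \<subseteq> monomials G n" "length xs \<le> h"
    "q = sum_list ys" "set ys \<subseteq> monomials G n" "length ys \<le> h'"
    using assms unfolding monomial_sums_def by blast
  then show ?thesis unfolding monomial_sums_def
    by (intro CollectI exI[of _ "xs @ ys"]) auto
qed

lemma monomial_sums_monomial_mult:
  assumes "u \<in> monomials G n" "q \<in> monomial_sums G m h"
  shows "u * q \<in> monomial_sums G (n + m) h"
proof -
  obtain ys where ys: "q = sum_list ys" "set ys \<subseteq> monomials G m" "length ys \<le> h"
    using assms unfolding monomial_sums_def by blast
  have "u * q = sum_list (map ((*) u) ys)"
    by (simp add: ys(1) sum_list_const_mult)
  moreover have "set (map ((*) u) ys) \<subseteq> monomials G (n + m)"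
    using ys(2) monomials_mult[OF assms(1)] by auto
  ultimately show ?thesis using ys(3) unfolding monomial_sums_def
    by (intro CollectI exI[of _ "map ((*) u) ys"]) auto
qed

lemma monomial_sums_mult:
  assumes "p \<in> monomial_sums G n h" "q \<in> monomial_sums G m h'"
  shows "p * q \<in> monomial_sums G (n + m) (h * h')"
proof -
  obtain xs where xs: "p = sum_list xs" "set xs \<subseteq> monomials G n" "length xs \<le> h"
    using assms unfolding monomial_sums_def by blast
  have "sum_list xs * q \<in> monomial_sums G (n + m) (length xs * h')"
    using xs(2)
  proof (induction xs)
    case Nil
    then show ?case by (simp add: zero_in_monomial_sums)
  next
    case (Cons u xs)
    then have "sum_list xs * q \<in> monomial_sums G (n + m) (length xs * h')"
      and "u * q \<in> monomial_sums G (n + m) h'"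
      using monomial_sums_monomial_mult[OF _ assms(2)] by auto
    then have "u * q + sum_list xs * q \<in> monomial_sums G (n + m) (h' + length xs * h')"
      by (intro monomial_sums_add)
    then show ?case by (simp add: algebra_simps)
  qed
  then show ?thesis
    using xs(1,3) by (auto elim!: monomial_sums_mono)
qed

lemma monomial_sums_sum:
  assumes "finite I" "\<And>i. i \<in> I \<Longrightarrow> p i \<in> monomial_sums G n h"
  shows "sum p I \<in> monomial_sums G n (card I * h)"
  using assms
proof (induction I rule: finite_induct)
  case empty
  then show ?case by (simp add: zero_in_monomial_sums)
next
  case (insert i I)
  then have "p i + sum p I \<in> monomial_sums G n (h + card I * h)"
    by (intro monomial_sums_add) auto
  then show ?case using insert by simp
qed

lemma small_sums_mono:
  assumes "p \<in> small_sums G n" "G \<subseteq> G'" "n \<le> n'"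
  shows "p \<in> small_sums G' n'"
  using assms by (auto elim!: monomial_sums_mono intro: power_increasing)

lemma small_sums_zero: "0 \<in> small_sums G n"
  by (rule zero_in_monomial_sums)

lemma small_sums_one: "1 \<in> small_sums G n"
  by (intro monomial_in_monomial_sums one_in_monomials) auto

lemma small_sums_generator: "g \<in> G \<Longrightarrow> 1 \<le> n \<Longrightarrow> g \<in> small_sums G n"
  by (intro monomial_in_monomial_sums generator_in_monomials) auto

lemma small_sums_add:
  assumes "p \<in> small_sums G n" "q \<in> small_sums G n"
  shows "p + q \<in> small_sums G (Suc n)"
  using monomial_sums_add[OF assms] by (rule monomial_sums_mono) auto

lemma small_sums_diff:
  assumes "-1 \<in> G" "p \<in> small_sums G n" "q \<in> small_sums G n"
  shows "p - q \<in> small_sums G (Suc n)"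
proof -
  have "(-1) * q \<in> monomial_sums G (1 + n) (2 ^ n)"
    using assms by (intro monomial_sums_monomial_mult generator_in_monomials) auto
  moreover have "p \<in> monomial_sums G (1 + n) (2 ^ n)"
    using assms(2) by (rule monomial_sums_mono) auto
  ultimately have "p + (-1) * q \<in> monomial_sums G (1 + n) (2 ^ n + 2 ^ n)"
    by (intro monomial_sums_add)
  then show ?thesis by (simp add: mult_2)
qed

lemma small_sums_mult:
  assumes "p \<in> small_sums G n" "q \<in> small_sums G m"
  shows "p * q \<in> small_sums G (n + m)"
  using monomial_sums_mult[OF assms] by (simp add: power_add)

lemma small_sums_power:
  assumes "p \<in> small_sums G n"
  shows "p ^ k \<in> small_sums G (k * n)"
proof (induction k)
  case 0
  show ?case using small_sums_one[of G 0] by simp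
next
  case (Suc k)
  then show ?case using small_sums_mult[OF assms] by simp
qed

lemma small_sums_prod:
  assumes "finite I" "\<And>i. i \<in> I \<Longrightarrow> p i \<in> small_sums G n"
  shows "prod p I \<in> small_sums G (card I * n)"
  using assms
proof (induction I rule: finite_induct)
  case empty
  show ?case using small_sums_one[of G 0] by simp
next
  case (insert i I)
  then have "p i * prod p I \<in> small_sums G (n + card I * n)"
    by (intro small_sums_mult) auto
  then show ?case using insert by simp
qed

lemma small_sums_sum:
  assumes "finite I" "\<And>i. i \<in> I \<Longrightarrow> p i \<in> small_sums G n" "card I \<le> 2 ^ k"
  shows "sum p I \<in> small_sums G (n + k)"
proof -
  have "sum p I \<in> monomial_sums G n (card I * 2 ^ n)"
    using assms by (intro monomial_sums_sum) auto
  moreover have "card I * 2 ^ n \<le> 2 ^ (n + k)"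
    using assms(3) by (simp add: power_add)
  ultimately show ?thesis by (auto elim!: monomial_sums_mono)
qed

lemma prod_list_eq_prod_count:
  fixes xs :: "'a::comm_monoid_mult list"
  assumes "finite G" "set xs \<subseteq> G"
  shows "prod_list xs = (\<Prod>g\<in>G. g ^ count_list xs g)"
  using assms(2)
proof (induction xs)
  case (Cons x xs)
  have "(\<Prod>g\<in>G. g ^ count_list (x # xs) g) = (\<Prod>g\<in>G. (if g = x then g else 1) * g ^ count_list xs g)"
    by (intro prod.cong) auto
  then show ?case using Cons assms(1) by (simp add: prod.distrib)
qed simp

lemma sum_list_eq_sum_count:
  fixes ys :: "'a::semiring_1 list"
  assumes "finite U" "set ys \<subseteq> U"
  shows "sum_list ys = (\<Sum>u\<in>U. of_nat (count_list ys u) * u)"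
  using assms(2)
proof (induction ys)
  case (Cons y ys)
  have "(\<Sum>u\<in>U. of_nat (count_list (y # ys) u) * u) =
      (\<Sum>u\<in>U. (if u = y then u else 0) + of_nat (count_list ys u) * u)"
    by (intro sum.cong) (auto simp: algebra_simps)
  then show ?case using Cons assms(1) by (simp add: sum.distrib)
qed simp

lemma card_monomials:
  assumes "finite G"
  shows "finite (monomials G n)" "card (monomials G n) \<le> (n + 1) ^ card G"
proof -
  let ?E = "G \<rightarrow>\<^sub>E {..n}"
  have fin: "finite ?E" using assms by (intro finite_PiE) auto
  have sub: "monomials G n \<subseteq> (\<lambda>k. \<Prod>g\<in>G. g ^ k g) ` ?E"
  proof
    fix u assume "u \<in> monomials G n"
    then obtain xs where xs: "u = prod_list xs" "set xs \<subseteq> G" "length xs \<le> n"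
      unfolding monomials_def by blast
    have "u = (\<Prod>g\<in>G. g ^ restrict (count_list xs) G g)"
      using prod_list_eq_prod_count[OF assms xs(2)] xs(1) by simp
    moreover have "restrict (count_list xs) G \<in> ?E"
      using xs(3) count_le_length[of xs] by (auto intro: order_trans)
    ultimately show "u \<in> (\<lambda>k. \<Prod>g\<in>G. g ^ k g) ` ?E" by blast
  qed
  then show "finite (monomials G n)" using fin finite_surj by blast
  have "card (monomials G n) \<le> card ?E" using sub fin by (rule surj_card_le[rotated])
  then show "card (monomials G n) \<le> (n + 1) ^ card G" using assms by (simp add: card_PiE)
qed

text \<open>A sum of monomials is determined by the multiplicities of the monomials in it.\<close>

lemma card_monomial_sums:
  assumes "finite G"
  shows "finite (monomial_sums G n h)"
    "card (monomial_sums G n h) \<le> (h + 1) ^ ((n + 1) ^ card G)"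
proof -
  let ?U = "monomials G n"
  let ?E = "?U \<rightarrow>\<^sub>E {..h}"
  have finU: "finite ?U" using card_monomials[OF assms] by blast
  then have fin: "finite ?E" by (intro finite_PiE) auto
  have sub: "monomial_sums G n h \<subseteq> (\<lambda>k. \<Sum>u\<in>?U. of_nat (k u) * u) ` ?E"
  proof
    fix p assume "p \<in> monomial_sums G n h"
    then obtain ys where ys: "p = sum_list ys" "set ys \<subseteq> ?U" "length ys \<le> h"
      unfolding monomial_sums_def by blast
    have "p = (\<Sum>u\<in>?U. of_nat (restrict (count_list ys) ?U u) * u)"
      using sum_list_eq_sum_count[OF finU ys(2)] ys(1) by simp
    moreover have "restrict (count_list ys) ?U \<in> ?E"
      using ys(3) count_le_length[of ys] by (auto intro: order_trans)
    ultimately show "p \<in> (\<lambda>k. \<Sum>u\<in>?U. of_nat (k u) * u) ` ?E" by blast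
  qed
  then show "finite (monomial_sums G n h)" using fin finite_surj by blast
  have "card (monomial_sums G n h) \<le> card ?E" using sub fin by (rule surj_card_le[rotated])
  also have "\<dots> = (h + 1) ^ card ?U" using finU by (simp add: card_PiE)
  also have "\<dots> \<le> (h + 1) ^ ((n + 1) ^ card G)"
    using card_monomials[OF assms] by (intro power_increasing) auto
  finally show "card (monomial_sums G n h) \<le> (h + 1) ^ ((n + 1) ^ card G)" .
qed

section \<open>Reduction of monomials in roots of a polynomial\<close>

text \<open>A power of a root of \<open>F\<close>, times the same power of the leading coefficient, is a combination of
  powers below \<open>degree F\<close>; each reduction step multiplies by a coefficient of \<open>F\<close> and subtracts, hence
  costs \<open>D + 1\<close>.\<close>

lemma power_reduction:
  fixes F :: "'a::comm_ring_1 poly"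
  assumes "-1 \<in> G" "\<And>j. coeff F j \<in> small_sums G D" "poly F x = 0" "degree F > 0"
  shows "\<exists>p. (\<forall>f. p f \<in> small_sums G (e * (D + 1))) \<and>
    lead_coeff F ^ e * x ^ e = (\<Sum>f<degree F. p f * x ^ f)"
proof (induction e)
  case 0
  have "(\<Sum>f<degree F. (if f = 0 then 1 else 0) * x ^ f) = (\<Sum>f\<in>{0}. x ^ f)"
    using assms(4) by (intro sum.mono_neutral_cong_right) auto
  then show ?case
    by (intro exI[of _ "\<lambda>f. if f = 0 then 1 else 0"])
      (use small_sums_one[of G 0] small_sums_zero[of G 0] in auto)
next
  case (Suc e)
  let ?a = "lead_coeff F"
  obtain k where k: "degree F = Suc k" using assms(4) gr0_conv_Suc by blast
  obtain p where p: "\<And>f. p f \<in> small_sums G (e * (D + 1))"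
    "?a ^ e * x ^ e = (\<Sum>f<degree F. p f * x ^ f)"
    using Suc by blast
  define p' where "p' f = (if f = 0 then 0 else ?a * p (f - 1)) - p k * coeff F f" for f
  have "p' f \<in> small_sums G (Suc e * (D + 1))" for f
  proof -
    have "?a * p (f - 1) \<in> small_sums G (D + e * (D + 1))"
      "p k * coeff F f \<in> small_sums G (e * (D + 1) + D)"
      using assms(2) p(1) by (blast intro: small_sums_mult)+
    then have "p' f \<in> small_sums G (Suc (D + e * (D + 1)))"
      unfolding p'_def
      by (intro small_sums_diff assms(1)) (auto simp: small_sums_zero add.commute)
    then show ?thesis by (simp add: algebra_simps)
  qed
  moreover have "?a ^ Suc e * x ^ Suc e = (\<Sum>f<degree F. p' f * x ^ f)"
  proof -
    have root: "?a * x ^ Suc k = - (\<Sum>f<Suc k. coeff F f * x ^ f)"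
    proof -
      have "(\<Sum>f<Suc (Suc k). coeff F f * x ^ f) = 0"
        using assms(3) unfolding poly_altdef k lessThan_Suc_atMost .
      then show ?thesis unfolding k by (simp only: sum.lessThan_Suc[of _ "Suc k"] eq_neg_iff_add_eq_0 add.commute)
    qed
    have shift: "(\<Sum>f<Suc k. (if f = 0 then 0 else ?a * p (f - 1)) * x ^ f) =
        (\<Sum>f<k. ?a * p f * x ^ Suc f)"
      by (simp add: sum.lessThan_Suc_shift del: sum.lessThan_Suc)
    have "?a ^ Suc e * x ^ Suc e = ?a * x * (\<Sum>f<Suc k. p f * x ^ f)"
      using p(2) k by (simp add: algebra_simps)
    also have "\<dots> = (\<Sum>f<k. ?a * p f * x ^ Suc f) + p k * (?a * x ^ Suc k)"
      by (simp add: sum_distrib_left distrib_left ac_simps)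
    also have "\<dots> = (\<Sum>f<Suc k. (if f = 0 then 0 else ?a * p (f - 1)) * x ^ f)
        - p k * (\<Sum>f<Suc k. coeff F f * x ^ f)"
      unfolding root shift by (simp only: mult_minus_right diff_conv_add_uminus)
    also have "\<dots> = (\<Sum>f<Suc k. p' f * x ^ f)"
      unfolding p'_def by (simp add: sum_distrib_left sum_subtractf left_diff_distrib mult.assoc
            del: sum.lessThan_Suc)
    finally show ?thesis using k by simp
  qed
  ultimately show ?case by blast
qed

text \<open>The same with a power of the leading coefficient that does not depend on \<open>e\<close>, so that the
  reductions of different monomials can be added.\<close>

lemma power_reduction_uniform:
  fixes F :: "'a::comm_ring_1 poly"
  assumes "-1 \<in> G" "\<And>j. coeff F j \<in> small_sums G D" "poly F x = 0" "degree F > 0" "e \<le> E"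
  shows "\<exists>p. (\<forall>f. p f \<in> small_sums G (E * (D + 1))) \<and>
    lead_coeff F ^ E * x ^ e = (\<Sum>f<degree F. p f * x ^ f)"
proof -
  let ?a = "lead_coeff F"
  obtain p where p: "\<And>f. p f \<in> small_sums G (e * (D + 1))"
    "?a ^ e * x ^ e = (\<Sum>f<degree F. p f * x ^ f)"
    using power_reduction[OF assms(1-4)] by blast
  have "?a ^ (E - e) * p f \<in> small_sums G (E * (D + 1))" for f
  proof -
    have "?a ^ (E - e) * p f \<in> small_sums G ((E - e) * D + e * (D + 1))"
      by (intro small_sums_mult small_sums_power assms(2) p(1))
    moreover have "(E - e) * D + e * (D + 1) \<le> (E - e) * (D + 1) + e * (D + 1)"
      by simp
    moreover have "\<dots> = E * (D + 1)"
      using assms(5) by (metis add_mult_distrib le_add_diff_inverse2)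
    ultimately show ?thesis by (auto elim: small_sums_mono)
  qed
  moreover have "?a ^ E * x ^ e = ?a ^ (E - e) * (?a ^ e * x ^ e)"
    using assms(5) by (simp add: mult.assoc[symmetric] power_add[symmetric])
  then have "?a ^ E * x ^ e = (\<Sum>f<degree F. ?a ^ (E - e) * p f * x ^ f)"
    unfolding p(2) by (simp add: sum_distrib_left mult.assoc)
  ultimately show ?thesis by (intro exI[of _ "\<lambda>f. ?a ^ (E - e) * p f"]) auto
qed

lemma monomial_reduction:
  fixes F :: "'a::comm_ring_1 poly" and x :: "nat \<Rightarrow> 'a"
  assumes "-1 \<in> G" "\<And>j. coeff F j \<in> small_sums G D" "\<And>i. i < q \<Longrightarrow> poly F (x i) = 0"
    "degree F > 0" "\<And>i. i < q \<Longrightarrow> e i \<le> E"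
  shows "\<exists>P. (\<forall>\<phi>. P \<phi> \<in> small_sums G (q * (E * (D + 1)))) \<and>
    lead_coeff F ^ (E * q) * (\<Prod>i<q. x i ^ e i) =
      (\<Sum>\<phi>\<in>{..<q} \<rightarrow>\<^sub>E {..<degree F}. P \<phi> * (\<Prod>i<q. x i ^ \<phi> i))"
proof -
  let ?a = "lead_coeff F"
  have "\<forall>i\<in>{..<q}. \<exists>p. (\<forall>f. p f \<in> small_sums G (E * (D + 1))) \<and>
    ?a ^ E * x i ^ e i = (\<Sum>f<degree F. p f * x i ^ f)"
    using assms by (intro ballI power_reduction_uniform) auto
  from bchoice[OF this] obtain p
    where "\<forall>i\<in>{..<q}. (\<forall>f. p i f \<in> small_sums G (E * (D + 1))) \<and>
      ?a ^ E * x i ^ e i = (\<Sum>f<degree F. p i f * x i ^ f)"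
    by blast
  then have p: "\<And>i f. i < q \<Longrightarrow> p i f \<in> small_sums G (E * (D + 1))"
    "\<And>i. i < q \<Longrightarrow> ?a ^ E * x i ^ e i = (\<Sum>f<degree F. p i f * x i ^ f)"
    by auto
  let ?P = "\<lambda>\<phi>. \<Prod>i<q. p i (\<phi> i)"
  have small: "?P \<phi> \<in> small_sums G (q * (E * (D + 1)))" for \<phi> :: "nat \<Rightarrow> nat"
    using small_sums_prod[of "{..<q}" "\<lambda>i. p i (\<phi> i)" G "E * (D + 1)"] p(1) by simp
  have "?a ^ (E * q) * (\<Prod>i<q. x i ^ e i) = (\<Prod>i<q. ?a ^ E * x i ^ e i)"
    by (simp add: prod.distrib power_mult)
  also have "\<dots> = (\<Prod>i<q. \<Sum>f<degree F. p i f * x i ^ f)"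
    using p(2) by (intro prod.cong) auto
  also have "\<dots> = (\<Sum>\<phi>\<in>{..<q} \<rightarrow>\<^sub>E {..<degree F}. ?P \<phi> * (\<Prod>i<q. x i ^ \<phi> i))"
    by (simp add: prod_sum_PiE prod.distrib)
  finally show ?thesis using small by (intro exI[of _ ?P]) blast
qed

text \<open>Multiplied by a fixed power of the leading coefficient, the sum of the monomials in any set of
  exponent vectors bounded by \<open>E\<close> becomes a combination of \<open>degree F ^ q\<close> monomials with coefficients
  in \<open>small_sums G W\<close>. If different sets have different sums, then counting gives the inequality.\<close>

lemma subset_sums_of_monomials_bound:
  fixes F :: "'a::idom poly" and x :: "nat \<Rightarrow> 'a"
  assumes "finite G" "-1 \<in> G" "\<And>j. coeff F j \<in> small_sums G D"
    "\<And>i. i < q \<Longrightarrow> poly F (x i) = 0" "degree F > 0"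
    and inj: "inj_on (\<lambda>S. \<Sum>e\<in>S. \<Prod>i<q. x i ^ e i) (Pow ({..<q} \<rightarrow>\<^sub>E {..E}))"
  defines "W \<equiv> q * E * (D + 2)"
  shows "(2 :: nat) ^ ((E + 1) ^ q) \<le> ((2 ^ W + 1) ^ ((W + 1) ^ card G)) ^ (degree F ^ q)"
proof -
  let ?a = "lead_coeff F"
  let ?M = "{..<q} \<rightarrow>\<^sub>E {..E}"
  let ?\<Phi> = "{..<q} \<rightarrow>\<^sub>E {..<degree F}"
  let ?R = "small_sums G W"
  let ?val = "\<lambda>P. \<Sum>\<phi>\<in>?\<Phi>. P \<phi> * (\<Prod>i<q. x i ^ \<phi> i)"
  let ?s = "\<lambda>S. ?a ^ (E * q) * (\<Sum>e\<in>S. \<Prod>i<q. x i ^ e i)"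
  have fin: "finite ?M" "finite ?\<Phi>" "finite ?R"
    using card_monomial_sums[OF assms(1)] by (auto intro: finite_PiE)
  have cardM: "card ?M = (E + 1) ^ q" by (simp add: card_PiE)
  have a0: "?a \<noteq> 0" using assms(5) by auto
  have "\<forall>e\<in>?M. \<exists>P. (\<forall>\<phi>. P \<phi> \<in> small_sums G (q * (E * (D + 1)))) \<and>
    ?a ^ (E * q) * (\<Prod>i<q. x i ^ e i) = ?val P"
    using assms by (intro ballI monomial_reduction) auto
  from bchoice[OF this] obtain P
    where "\<forall>e\<in>?M. (\<forall>\<phi>. P e \<phi> \<in> small_sums G (q * (E * (D + 1)))) \<and>
      ?a ^ (E * q) * (\<Prod>i<q. x i ^ e i) = ?val (P e)"
    by blast
  then have P: "\<And>e \<phi>. e \<in> ?M \<Longrightarrow> P e \<phi> \<in> small_sums G (q * (E * (D + 1)))"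
    "\<And>e. e \<in> ?M \<Longrightarrow> ?a ^ (E * q) * (\<Prod>i<q. x i ^ e i) = ?val (P e)"
    by auto
  have sub: "?s ` Pow ?M \<subseteq> ?val ` (?\<Phi> \<rightarrow>\<^sub>E ?R)"
  proof
    fix y assume "y \<in> ?s ` Pow ?M"
    then obtain S where S: "S \<subseteq> ?M" "y = ?s S" by blast
    let ?Q = "restrict (\<lambda>\<phi>. \<Sum>e\<in>S. P e \<phi>) ?\<Phi>"
    have "card S \<le> card ?M" using S(1) fin(1) by (rule card_mono[rotated])
    also have "\<dots> \<le> (2 ^ E) ^ q" unfolding cardM by (intro power_mono) (simp_all add: Suc_leI less_exp)
    finally have cardS: "card S \<le> 2 ^ (E * q)" by (simp add: power_mult)
    have "(\<Sum>e\<in>S. P e \<phi>) \<in> small_sums G (q * (E * (D + 1)) + E * q)" for \<phi>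
      using S(1) fin(1) P(1) cardS
      by (intro small_sums_sum) (auto intro: finite_subset)
    moreover have "q * (E * (D + 1)) + E * q = W"
      unfolding W_def by (simp add: algebra_simps)
    ultimately have "?Q \<in> ?\<Phi> \<rightarrow>\<^sub>E ?R" by auto
    moreover have "y = (\<Sum>e\<in>S. ?val (P e))"
      unfolding S(2) sum_distrib_left using S(1) P(2) by (intro sum.cong) auto
    then have "y = ?val ?Q"
      by (simp add: sum_distrib_right sum.swap[of _ S])
    ultimately show "y \<in> ?val ` (?\<Phi> \<rightarrow>\<^sub>E ?R)" by blast
  qed
  have "inj_on ?s (Pow ?M)"
    using inj a0 by (simp add: inj_on_def)
  then have "(2 :: nat) ^ ((E + 1) ^ q) = card (?s ` Pow ?M)"
    using fin(1) cardM by (simp add: card_image card_Pow)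
  also have "\<dots> \<le> card (?\<Phi> \<rightarrow>\<^sub>E ?R)"
    by (rule surj_card_le[OF _ sub]) (use fin in \<open>auto intro: finite_PiE\<close>)
  also have "\<dots> = card ?R ^ (degree F ^ q)"
    using fin by (simp add: card_PiE)
  also have "\<dots> \<le> ((2 ^ W + 1) ^ ((W + 1) ^ card G)) ^ (degree F ^ q)"
    using card_monomial_sums[OF assms(1)] by (intro power_mono) auto
  finally show ?thesis .
qed

section \<open>Counting subset sums\<close>

text \<open>For \<open>k < r\<close> generators, \<open>2 r\<close> roots suffice. The exponent bound \<open>E\<close> is chosen so that
  \<open>(W + 1) D\<^sup>2 < (E + 1)\<^sup>2\<close>, where \<open>W\<close> is linear in \<open>E\<close>.\<close>

lemma reductions_fewer_than_subsets:
  fixes D r :: nat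
  assumes "D > 0" "r > 0"
  defines "E \<equiv> 2 * r * (D + 2) * D ^ 2"
  defines "W \<equiv> 2 * r * E * (D + 2)"
  assumes "k + 1 \<le> r" "l \<le> D"
  shows "((2 ^ W + 1) ^ ((W + 1) ^ k)) ^ (l ^ (2 * r)) < (2 :: nat) ^ ((E + 1) ^ (2 * r))"
proof -
  have "(W + 1) * D ^ 2 \<le> 2 * r * (D + 2) * (E + 1) * D ^ 2"
    using assms(1,2) unfolding W_def by (intro mult_right_mono) (auto simp: algebra_simps)
  also have "\<dots> = E * (E + 1)" unfolding E_def by (simp add: algebra_simps)
  also have "\<dots> < (E + 1) ^ 2" by (simp add: power2_eq_square)
  finally have key: "(W + 1) * D ^ 2 < (E + 1) ^ 2" .
  have "((2 ^ W + 1) ^ ((W + 1) ^ k)) ^ (l ^ (2 * r)) \<le>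
      (((2::nat) ^ (W + 1)) ^ ((W + 1) ^ k)) ^ (l ^ (2 * r))"
    by (intro power_mono) auto
  also have "\<dots> = 2 ^ ((W + 1) ^ (k + 1) * l ^ (2 * r))"
    by (simp only: power_mult[symmetric] Suc_eq_plus1[symmetric] power_Suc[of "Suc W" k])
  also have "\<dots> \<le> 2 ^ ((W + 1) ^ r * D ^ (2 * r))"
    using assms(5,6) by (intro power_increasing mult_mono power_mono) auto
  also have "(W + 1) ^ r * D ^ (2 * r) = ((W + 1) * D ^ 2) ^ r"
    by (simp only: power_mult power_mult_distrib)
  also have "(2::nat) ^ \<dots> < 2 ^ (((E + 1) ^ 2) ^ r)"
    using key assms(2) by (intro power_strict_increasing power_strict_mono) auto
  finally show ?thesis by (simp add: power_mult)
qed

lemma digits_inj: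
  fixes B :: nat
  assumes "\<And>i. i < q \<Longrightarrow> e i < B" "\<And>i. i < q \<Longrightarrow> e' i < B"
    and "(\<Sum>i<q. e i * B ^ i) = (\<Sum>i<q. e' i * B ^ i)" "i < q"
  shows "e i = e' i"
  using assms
proof (induction q arbitrary: e e' i)
  case (Suc q)
  let ?t = "\<lambda>e. \<Sum>i<q. e (Suc i) * B ^ i"
  have split: "(\<Sum>i<Suc q. e i * B ^ i) = e 0 + B * ?t e" for e :: "nat \<Rightarrow> nat"
    by (simp add: sum.lessThan_Suc_shift sum_distrib_left algebra_simps del: sum.lessThan_Suc)
  have lt: "e 0 < B" "e' 0 < B" using Suc.prems by auto
  have eq: "e 0 + B * ?t e = e' 0 + B * ?t e'" using Suc.prems(3) unfolding split .
  have "e 0 = (e 0 + B * ?t e) mod B" "e' 0 = (e' 0 + B * ?t e') mod B"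
    using lt by auto
  then have e0: "e 0 = e' 0" using eq by simp
  then have "?t e = ?t e'" using eq lt by simp
  then have "e (Suc j) = e' (Suc j)" if "j < q" for j
    using Suc.prems(1,2) that by (intro Suc.IH[of "e \<circ> Suc" "e' \<circ> Suc" j, unfolded comp_def]) auto
  then show ?case using e0 Suc.prems(4) by (cases i) auto
qed simp

lemma subset_sums_of_iterated_powers_inj:
  assumes "E < 2 ^ d"
  shows "inj_on (\<lambda>S. \<Sum>e\<in>S. \<Prod>i<q. (2 ^ (2 ^ (d * i)) :: complex) ^ e i) (Pow ({..<q} \<rightarrow>\<^sub>E {..E}))"
proof -
  let ?M = "{..<q} \<rightarrow>\<^sub>E {..E}"
  define N where "N e = (\<Sum>i<q. e i * (2 ^ d) ^ i)" for e :: "nat \<Rightarrow> nat"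
  have fin: "finite ?M" by (intro finite_PiE) auto
  have injN: "inj_on N ?M"
  proof (rule inj_onI)
    fix e e' assume "e \<in> ?M" "e' \<in> ?M" "N e = N e'"
    note e = this
    have "e i < 2 ^ d" "e' i < 2 ^ d" if "i < q" for i
      using e(1,2) assms that by (auto simp: PiE_iff intro: le_less_trans)
    then have "e i = e' i" if "i < q" for i
      using digits_inj[of q e "2 ^ d" e' i] e(3) that unfolding N_def by blast
    then show "e = e'"
      using e(1,2) by (intro PiE_ext[of e _ _ e']) auto
  qed
  have "(\<Sum>e\<in>S. \<Prod>i<q. (2 ^ (2 ^ (d * i)) :: complex) ^ e i) = of_nat (set_encode (N ` S))"
    if "S \<subseteq> ?M" for S
  proof -
    have "(\<Prod>i<q. (2 ^ (2 ^ (d * i)) :: complex) ^ e i) = 2 ^ N e" for e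
      unfolding N_def by (simp add: power_mult[symmetric] power_sum mult.commute)
    moreover have "inj_on N S" using injN that by (rule inj_on_subset)
    ultimately show ?thesis
      by (simp add: set_encode_def sum.reindex)
  qed
  note val = this
  show ?thesis
  proof (rule inj_onI)
    fix S S' assume S: "S \<in> Pow ?M" "S' \<in> Pow ?M"
      "(\<Sum>e\<in>S. \<Prod>i<q. (2 ^ (2 ^ (d * i)) :: complex) ^ e i) =
       (\<Sum>e\<in>S'. \<Prod>i<q. (2 ^ (2 ^ (d * i)) :: complex) ^ e i)"
    then have "set_encode (N ` S) = set_encode (N ` S')"
      using val[of S] val[of S'] by simp
    moreover have "finite (N ` S)" "finite (N ` S')"
      using S(1,2) fin by (auto intro: finite_subset)
    ultimately have "N ` S = N ` S'" by (simp add: set_encode_eq)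
    then show "S = S'" using injN S(1,2) by (simp add: inj_on_image_eq_iff)
  qed
qed

section \<open>The generic path of a decision tree\<close>

text \<open>The polynomials built from the variable \<open>[:0, 1:]\<close> and the constants \<open>C\<close> with integer
  coefficients are sums of monomials in these generators; \<open>-1\<close> is added to have signs.\<close>

definition poly_generators :: "complex set \<Rightarrow> complex poly set" where
  "poly_generators C = insert [:0, 1:] ((\<lambda>c. [:c:]) ` insert (-1) C)"

lemma poly_generators_mono: "C \<subseteq> C' \<Longrightarrow> poly_generators C \<subseteq> poly_generators C'"
  unfolding poly_generators_def by auto

lemma prod_list_poly_generators:
  assumes "set xs \<subseteq> poly_generators C"
  shows "\<exists>u k. prod_list xs = monom u k \<and> k \<le> length xs \<and>
    u \<in> monomials (insert (-1) C) (length xs)"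
  using assms
proof (induction xs)
  case Nil
  then show ?case
    by (intro exI[of _ 1] exI[of _ 0]) (auto simp: one_in_monomials)
next
  case (Cons g xs)
  then obtain u k where uk: "prod_list xs = monom u k" "k \<le> length xs"
    "u \<in> monomials (insert (-1) C) (length xs)" by auto
  from Cons.prems consider "g = [:0, 1:]" | c where "c \<in> insert (-1) C" "g = [:c:]"
    unfolding poly_generators_def by auto
  then show ?case
  proof cases
    case 1
    have "prod_list (g # xs) = monom u (Suc k)"
      using 1 uk(1) by (simp add: monom_Suc)
    moreover have "u \<in> monomials (insert (-1) C) (length (g # xs))"
      using uk(3) monomials_mono[of "insert (-1) C" "insert (-1) C" "length xs" "length (g # xs)"]
      by auto
    ultimately show ?thesis using uk(2) by (intro exI[of _ u] exI[of _ "Suc k"]) auto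
  next
    case 2
    have "prod_list (g # xs) = monom (c * u) k"
      using 2 uk(1) by (simp add: smult_monom)
    moreover have "c * u \<in> monomials (insert (-1) C) (1 + length xs)"
      by (rule monomials_mult[OF generator_in_monomials[OF 2(1) order_refl] uk(3)])
    ultimately show ?thesis using uk(2) by (intro exI[of _ "c * u"] exI[of _ k]) auto
  qed
qed

text \<open>Passage from polynomials to their coefficients: the bounds on length and number of monomials
  are inherited by each coefficient.\<close>

lemma coeff_degree_small_sums:
  assumes "p \<in> monomial_sums (poly_generators C) n h"
  shows "coeff p j \<in> monomial_sums (insert (-1) C) n h" "degree p \<le> n"
proof -
  have mon: "(coeff m j = 0 \<or> coeff m j \<in> monomials (insert (-1) C) n) \<and> degree m \<le> n"
    if m: "m \<in> monomials (poly_generators C) n" for m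
  proof -
    obtain xs where xs: "m = prod_list xs" "set xs \<subseteq> poly_generators C" "length xs \<le> n"
      using m unfolding monomials_def by blast
    obtain u k where uk: "m = monom u k" "k \<le> length xs"
      "u \<in> monomials (insert (-1) C) (length xs)"
      using prod_list_poly_generators[OF xs(2)] xs(1) by auto
    then have "u \<in> monomials (insert (-1) C) n"
      using monomials_mono[of "insert (-1) C" "insert (-1) C" "length xs" n] xs(3) by auto
    moreover have "degree m \<le> n"
      using uk(1,2) xs(3) degree_monom_le[of u k] by auto
    ultimately show ?thesis using uk(1) by auto
  qed
  obtain ys where ys: "p = sum_list ys" "set ys \<subseteq> monomials (poly_generators C) n" "length ys \<le> h"
    using assms unfolding monomial_sums_def by blast
  have "coeff (sum_list ys) j \<in> monomial_sums (insert (-1) C) n (length ys) \<and>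
      degree (sum_list ys) \<le> n"
    using ys(2)
  proof (induction ys)
    case Nil
    then show ?case by (simp add: zero_in_monomial_sums)
  next
    case (Cons m ys)
    then have IH: "coeff (sum_list ys) j \<in> monomial_sums (insert (-1) C) n (length ys)"
      "degree (sum_list ys) \<le> n" and m: "m \<in> monomials (poly_generators C) n" by auto
    have "coeff m j \<in> monomial_sums (insert (-1) C) n 1"
      using mon[OF m] by (auto simp: zero_in_monomial_sums intro: monomial_in_monomial_sums)
    from monomial_sums_add[OF this IH(1)]
    show ?case using mon[OF m] IH(2) by (auto intro: degree_add_le)
  qed
  then show "coeff p j \<in> monomial_sums (insert (-1) C) n h" "degree p \<le> n"
    using ys by (auto elim: monomial_sums_mono)
qed

text \<open>A quantity computed on a path, as a rational function of the input: an unreduced pair of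
  numerator and denominator.\<close>

type_synonym fraction = "complex poly \<times> complex poly"

text \<open>The value of a fraction; meaningful only where the denominator does not vanish.\<close>

definition frac_val :: "complex \<Rightarrow> fraction \<Rightarrow> complex" where
  "frac_val x r = poly (fst r) x / poly (snd r) x"

text \<open>The rational function that an operand denotes, given those of the earlier results.\<close>

primrec frac_operand :: "fraction list \<Rightarrow> tree_operand \<Rightarrow> fraction" where
  "frac_operand rs Input = ([:0, 1:], 1)"
| "frac_operand rs (TConst c) = ([:c:], 1)"
| "frac_operand rs (Result j) = rs ! j"

primrec operand_constants :: "tree_operand \<Rightarrow> complex set" where
  "operand_constants Input = {}"
| "operand_constants (TConst c) = {c}"
| "operand_constants (Result j) = {}"

text \<open>The arithmetic operations on fractions; the denominator stays nonzero if, in the case of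
  \<open>Div\<close>, the numerator of the divisor is nonzero.\<close>

primrec frac_op :: "arith_op \<Rightarrow> fraction \<Rightarrow> fraction \<Rightarrow> fraction" where
  "frac_op Add r r' = (fst r * snd r' + fst r' * snd r, snd r * snd r')"
| "frac_op Sub r r' = (fst r * snd r' - fst r' * snd r, snd r * snd r')"
| "frac_op Mul r r' = (fst r * fst r', snd r * snd r')"
| "frac_op Div r r' = (fst r * snd r', snd r * fst r')"

text \<open>Fractions with nonzero denominator whose numerator and denominator are small.\<close>

definition small_fraction :: "complex set \<Rightarrow> nat \<Rightarrow> fraction \<Rightarrow> bool" where
  "small_fraction C s r \<longleftrightarrow> fst r \<in> small_sums (poly_generators C) s \<and>
     snd r \<in> small_sums (poly_generators C) s \<and> snd r \<noteq> 0"

lemma small_fraction_mono: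
  assumes "small_fraction C s r" "C \<subseteq> C'" "s \<le> s'"
  shows "small_fraction C' s' r"
  using assms poly_generators_mono[OF assms(2)] unfolding small_fraction_def
  by (auto elim: small_sums_mono)

lemma small_frac_operand:
  assumes "wf_operand (length rs) p" "\<forall>r\<in>set rs. small_fraction C s r" "s \<ge> 1"
    "operand_constants p \<subseteq> C"
  shows "small_fraction C s (frac_operand rs p)"
  using assms
  by (cases p) (auto simp: small_fraction_def small_sums_one poly_generators_def
      intro!: small_sums_generator)

lemma small_frac_op:
  assumes "small_fraction C s r" "small_fraction C s r'" "f = Div \<Longrightarrow> fst r' \<noteq> 0"
  shows "small_fraction C (Suc (s + s)) (frac_op f r r')"
proof -
  let ?G = "poly_generators C"
  have m1: "-1 \<in> ?G" unfolding poly_generators_def by (auto simp: one_pCons)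
  have prods: "u * v \<in> small_sums ?G (s + s)" "u * v \<in> small_sums ?G (Suc (s + s))"
    if "u \<in> small_sums ?G s" "v \<in> small_sums ?G s" for u v
    using small_sums_mult[OF that] small_sums_mono[OF small_sums_mult[OF that] order_refl le_SucI]
    by blast+
  show ?thesis using assms m1
    by (cases f) (auto simp: small_fraction_def prods simp del: power_Suc
        intro!: small_sums_add small_sums_diff)
qed

lemma tree_val_frac:
  assumes "wf_operand (length rs) p"
  shows "tree_val x (map (frac_val x) rs) p = frac_val x (frac_operand rs p)"
  using assms by (cases p) (auto simp: frac_val_def)

lemma apply_op_frac:
  assumes "poly (snd r) x \<noteq> 0" "poly (snd r') x \<noteq> 0" "f = Div \<Longrightarrow> poly (fst r') x \<noteq> 0"
  shows "apply_op f (frac_val x r) (frac_val x r') = Some (frac_val x (frac_op f r r'))"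
    "poly (snd (frac_op f r r')) x \<noteq> 0"
  using assms by (cases f; simp add: frac_val_def field_simps)+

text \<open>All inputs outside the zero set of a small nonzero polynomial \<open>F\<close> have the same outcome. The
  subtree is entered with symbolic results \<open>rs\<close> that involve the constants \<open>C0\<close>; the set \<open>C\<close>
  collects the constants met afterwards on the generic path. The outcome is \<open>None\<close> if that path
  runs into a division by the zero polynomial. One operation takes the size \<open>s\<close> to at most \<open>3 s\<close>, and
  one factor of \<open>F\<close> has size at most \<open>s\<close>; so a bound \<open>B\<close> with \<open>3 B k + 1 \<le> B (k + 1)\<close> is needed,
  and \<open>B k = 4 ^ k\<close> is one.\<close>

lemma generic_path:
  assumes "wf_dtree (length rs) t" "\<forall>r\<in>set rs. small_fraction C0 s r" "s \<ge> 1"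
  shows "\<exists>C F out. finite C \<and> card C \<le> 2 * depth t \<and> F \<noteq> 0 \<and>
    F \<in> small_sums (poly_generators (C0 \<union> C)) (s * 4 ^ depth t) \<and>
    (\<forall>x. poly F x \<noteq> 0 \<and> (\<forall>r\<in>set rs. poly (snd r) x \<noteq> 0) \<longrightarrow>
      outcome x t (map (frac_val x) rs) = out)"
  using assms
proof (induction t arbitrary: rs C0 s)
  case (Leaf b)
  show ?case
    by (rule exI[of _ "{}"], rule exI[of _ 1]) (auto simp: small_sums_one)
next
  case (Compute f p q t)
  define Cp where "Cp = operand_constants p \<union> operand_constants q"
  have Cp: "finite Cp" "card Cp \<le> 2"
    unfolding Cp_def by (cases p; cases q; simp add: card_insert_if)+
  define P where "P = frac_operand rs p"
  define Q where "Q = frac_operand rs q"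
  have wf: "wf_operand (length rs) p" "wf_operand (length rs) q" "wf_dtree (Suc (length rs)) t"
    using Compute.prems(1) by auto
  have rs: "\<forall>r\<in>set rs. small_fraction (C0 \<union> Cp) s r"
    using Compute.prems(2) by (auto elim: small_fraction_mono)
  have PQ: "small_fraction (C0 \<union> Cp) s P" "small_fraction (C0 \<union> Cp) s Q"
    unfolding P_def Q_def using rs wf Compute.prems(3)
    by (auto intro!: small_frac_operand simp: Cp_def)
  have den: "poly (snd P) x \<noteq> 0" "poly (snd Q) x \<noteq> 0"
    if "\<forall>r\<in>set rs. poly (snd r) x \<noteq> 0" for x
    using that wf unfolding P_def Q_def by (cases p; cases q; simp)+
  note val = tree_val_frac[OF wf(1), folded P_def] tree_val_frac[OF wf(2), folded Q_def]
  show ?case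
  proof (cases "f = Div \<and> fst Q = 0")
    case True
    then have "outcome x (Compute f p q t) (map (frac_val x) rs) = None" for x
      by (simp add: val) (simp add: frac_val_def)
    then show ?thesis
      by (intro exI[of _ "{}"] exI[of _ 1] exI[of _ None]) (auto simp: small_sums_one)
  next
    case False
    \<comment> \<open>the new factor of \<open>F\<close> excludes the inputs that divide by zero\<close>
    define N where "N = (if f = Div then fst Q else 1)"
    have N: "N \<noteq> 0" "N \<in> small_sums (poly_generators (C0 \<union> Cp)) s"
      using False PQ(2) small_sums_one unfolding N_def small_fraction_def by auto
    let ?R = "frac_op f P Q"
    have "small_fraction (C0 \<union> Cp) (Suc (s + s)) ?R"
      using False by (intro small_frac_op PQ) auto
    then have "small_fraction (C0 \<union> Cp) (3 * s) ?R"
      using Compute.prems(3) by (auto elim: small_fraction_mono)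
    moreover have "small_fraction (C0 \<union> Cp) (3 * s) r" if "r \<in> set rs" for r
      using small_fraction_mono[OF rs[rule_format, OF that], of "C0 \<union> Cp" "3 * s"] by simp
    ultimately have "\<forall>r\<in>set (rs @ [?R]). small_fraction (C0 \<union> Cp) (3 * s) r"
      by simp
    from Compute.IH[OF _ this] obtain C F out where IH: "finite C" "card C \<le> 2 * depth t" "F \<noteq> 0"
      "F \<in> small_sums (poly_generators (C0 \<union> Cp \<union> C)) (3 * s * 4 ^ depth t)"
      "\<And>x. poly F x \<noteq> 0 \<Longrightarrow> \<forall>r\<in>set (rs @ [?R]). poly (snd r) x \<noteq> 0 \<Longrightarrow>
        outcome x t (map (frac_val x) (rs @ [?R])) = out"
      using wf(3) Compute.prems(3) by auto
    have "F * N \<in> small_sums (poly_generators (C0 \<union> Cp \<union> C)) (3 * s * 4 ^ depth t + s)"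
      using N(2) poly_generators_mono[of "C0 \<union> Cp" "C0 \<union> Cp \<union> C"]
      by (intro small_sums_mult IH(4)) (auto elim: small_sums_mono)
    moreover have "3 * s * 4 ^ depth t + s \<le> s * 4 ^ depth (Compute f p q t)"
      by simp
    ultimately have "F * N \<in> small_sums (poly_generators (C0 \<union> (Cp \<union> C)))
        (s * 4 ^ depth (Compute f p q t))"
      by (auto elim: small_sums_mono simp: Un_assoc)
    moreover have "card (Cp \<union> C) \<le> 2 * depth (Compute f p q t)"
      using card_Un_le[of Cp C] Cp(2) IH(2) by simp
    moreover have "outcome x (Compute f p q t) (map (frac_val x) rs) = out"
      if x: "poly (F * N) x \<noteq> 0" "\<forall>r\<in>set rs. poly (snd r) x \<noteq> 0" for x
    proof -
      have "f = Div \<Longrightarrow> poly (fst Q) x \<noteq> 0" using x(1) unfolding N_def by auto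
      note R = apply_op_frac[OF den[OF x(2)] this]
      then show ?thesis using IH(5)[of x] x by (simp add: val)
    qed
    ultimately show ?thesis using Cp(1) IH(1,3) N(1)
      by (intro exI[of _ "Cp \<union> C"] exI[of _ "F * N"] exI[of _ out]) auto
  qed
next
  case (Branch j t u)
  define N where "N = fst (rs ! j)"
  have j: "j < length rs" and wf: "wf_dtree (length rs) t" "wf_dtree (length rs) u"
    using Branch.prems(1) by auto
  have small: "small_fraction C0 s (rs ! j)" using Branch.prems(2) j by simp
  show ?case
  proof (cases "N = 0")
    case True
    from Branch.IH(1)[OF wf(1) Branch.prems(2,3)] obtain C F out where IH:
      "finite C" "card C \<le> 2 * depth t" "F \<noteq> 0"
      "F \<in> small_sums (poly_generators (C0 \<union> C)) (s * 4 ^ depth t)"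
      "\<And>x. poly F x \<noteq> 0 \<Longrightarrow> \<forall>r\<in>set rs. poly (snd r) x \<noteq> 0 \<Longrightarrow>
        outcome x t (map (frac_val x) rs) = out"
      by auto
    have "s * 4 ^ depth t \<le> s * 4 ^ depth (Branch j t u)"
      by (intro mult_left_mono power_increasing) auto
    then have "F \<in> small_sums (poly_generators (C0 \<union> C)) (s * 4 ^ depth (Branch j t u))"
      using IH(4) by (auto elim: small_sums_mono)
    moreover have "map (frac_val x) rs ! j = 0" for x
      using True j by (simp add: N_def frac_val_def)
    ultimately show ?thesis using IH
      by (intro exI[of _ C] exI[of _ F] exI[of _ out]) auto
  next
    case False
    from Branch.IH(2)[OF wf(2) Branch.prems(2,3)] obtain C F out where IH:
      "finite C" "card C \<le> 2 * depth u" "F \<noteq> 0"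
      "F \<in> small_sums (poly_generators (C0 \<union> C)) (s * 4 ^ depth u)"
      "\<And>x. poly F x \<noteq> 0 \<Longrightarrow> \<forall>r\<in>set rs. poly (snd r) x \<noteq> 0 \<Longrightarrow>
        outcome x u (map (frac_val x) rs) = out"
      by auto
    have "F * N \<in> small_sums (poly_generators (C0 \<union> C)) (s * 4 ^ depth u + s)"
      using small poly_generators_mono[of C0 "C0 \<union> C"] unfolding N_def small_fraction_def
      by (intro small_sums_mult IH(4)) (auto elim: small_sums_mono)
    moreover have "s * 4 ^ depth u + s \<le> s * 4 ^ Suc (depth u)"
      by simp
    then have "s * 4 ^ depth u + s \<le> s * 4 ^ depth (Branch j t u)"
      by (rule order_trans) (intro mult_left_mono power_increasing, auto)
    ultimately have "F * N \<in> small_sums (poly_generators (C0 \<union> C)) (s * 4 ^ depth (Branch j t u))"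
      by (auto elim: small_sums_mono)
    moreover have "map (frac_val x) rs ! j \<noteq> 0"
      if "poly (F * N) x \<noteq> 0" "\<forall>r\<in>set rs. poly (snd r) x \<noteq> 0" for x
      using that j by (simp add: N_def frac_val_def)
    ultimately show ?thesis using IH False
      by (intro exI[of _ C] exI[of _ "F * N"] exI[of _ out]) auto
  qed
qed

lemma decided_finite_set_small_polynomial:
  assumes "wf_dtree 0 t" "\<And>x. outcome x t [] = Some (x \<in> S)" "finite S"
  shows "\<exists>C F. finite C \<and> card C \<le> 2 * depth t \<and> F \<noteq> 0 \<and>
    F \<in> small_sums (poly_generators C) (4 ^ depth t) \<and> (\<forall>x\<in>S. poly F x = 0)"
proof -
  obtain C F out where F: "finite C" "card C \<le> 2 * depth t" "F \<noteq> 0"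
    "F \<in> small_sums (poly_generators C) (4 ^ depth t)"
    "\<And>x. poly F x \<noteq> 0 \<Longrightarrow> outcome x t [] = out"
    using generic_path[of "[]" t "{}" 1] assms(1) by auto
  have "finite ({x. poly F x = 0} \<union> S)"
    using poly_roots_finite[OF F(3)] assms(3) by simp
  then obtain y where "y \<notin> {x. poly F x = 0} \<union> S"
    using ex_new_if_finite[OF infinite_UNIV_char_0] by blast
  then have "out = Some False" using F(5)[of y] assms(2)[of y] by simp
  then have "\<forall>x\<in>S. poly F x = 0" using F(5) assms(2) by fastforce
  then show ?thesis using F by blast
qed

section \<open>Unrolling machines into decision trees\<close>

text \<open>During the unrolling of a machine, \<open>\<sigma>\<close> records for every tape cell the tree operand that holds
  its content.\<close>

primrec symbolic_val :: "(int \<Rightarrow> tree_operand) \<Rightarrow> machine_operand \<Rightarrow> tree_operand" where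
  "symbolic_val \<sigma> (Cell i) = \<sigma> i"
| "symbolic_val \<sigma> (MConst c) = TConst c"

text \<open>A branching node can only test a computed result. So the operand, which may be the input or a
  constant, is first copied into result \<open>m\<close> by adding 0 to it.\<close>

definition zero_test :: "tree_operand \<Rightarrow> nat \<Rightarrow> dtree \<Rightarrow> dtree \<Rightarrow> dtree" where
  "zero_test p m t u = Compute Add p (TConst 0) (Branch m t u)"

text \<open>The decision tree of the first \<open>N\<close> steps of \<open>M\<close> from node \<open>k\<close>, where \<open>m\<close> results have been
  computed before. Shifts cost nothing, since they only relabel \<open>\<sigma>\<close>. When the machine halts, the
  content of cell 1 is tested: the answer is NO if it is zero. A machine that has not halted after \<open>N\<close>
  steps is treated in the same way, a case that does not arise for machines that respect the time
  bound.\<close>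

primrec unroll :: "machine \<Rightarrow> nat \<Rightarrow> nat \<Rightarrow> (int \<Rightarrow> tree_operand) \<Rightarrow> nat \<Rightarrow> dtree" where
  "unroll M 0 k \<sigma> m = zero_test (\<sigma> 1) m (Leaf False) (Leaf True)"
| "unroll M (Suc N) k \<sigma> m =
     (case M ! k of
        MCompute i f p q k' \<Rightarrow>
          Compute f (symbolic_val \<sigma> p) (symbolic_val \<sigma> q)
            (unroll M N k' (\<sigma>(i := Result m)) (Suc m))
      | MBranch i k' l' \<Rightarrow>
          zero_test (\<sigma> i) m (unroll M N k' \<sigma> (Suc m)) (unroll M N l' \<sigma> (Suc m))
      | ShiftLeft k' \<Rightarrow> unroll M N k' (\<lambda>i. \<sigma> (i + 1)) m
      | ShiftRight k' \<Rightarrow> unroll M N k' (\<lambda>i. \<sigma> (i - 1)) m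
      | Output \<Rightarrow> zero_test (\<sigma> 1) m (Leaf False) (Leaf True))"

lemma depth_unroll: "depth (unroll M N k \<sigma> m) \<le> 2 * N + 2"
proof (induction N arbitrary: k \<sigma> m)
  case 0
  then show ?case by (simp add: zero_test_def)
next
  case (Suc N)
  have *: "depth (unroll M N k \<sigma> m) \<le> Suc (2 * N + 2)" "depth (unroll M N k \<sigma> m) \<le> Suc (Suc (2 * N + 2))" for k \<sigma> m
    using Suc[of k \<sigma> m] by simp_all
  show ?case using Suc * by (cases "M ! k") (auto simp: zero_test_def)
qed

lemma wf_operand_mono: "wf_operand m p \<Longrightarrow> m \<le> m' \<Longrightarrow> wf_operand m' p"
  by (cases p) auto

lemma wf_symbolic_val: "(\<And>i. wf_operand m (\<sigma> i)) \<Longrightarrow> wf_operand m (symbolic_val \<sigma> p)"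
  by (cases p) auto

lemma wf_unroll:
  assumes "\<And>i. wf_operand m (\<sigma> i)"
  shows "wf_dtree m (unroll M N k \<sigma> m)"
  using assms
proof (induction N arbitrary: k \<sigma> m)
  case 0
  then show ?case by (simp add: zero_test_def)
next
  case (Suc N)
  have "wf_operand (Suc m) (\<sigma> i)" for i
    using Suc.prems by (rule wf_operand_mono) simp
  then show ?case using Suc.prems
    by (cases "M ! k") (auto simp: zero_test_def intro!: Suc.IH wf_symbolic_val)
qed

lemma tree_val_append:
  "wf_operand (length rs) p \<Longrightarrow> tree_val x (rs @ rs') p = tree_val x rs p"
  by (cases p) (auto simp: nth_append)

lemma outcome_zero_test:
  assumes "wf_operand (length rs) p"
  shows "outcome x (zero_test p (length rs) t u) rs =
    (if tree_val x rs p = 0 then outcome x t (rs @ [tree_val x rs p])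
     else outcome x u (rs @ [tree_val x rs p]))"
  by (simp add: zero_test_def nth_append)

lemma symbolic_val_correct:
  "tree_val x rs (symbolic_val \<sigma> p) = machine_val (\<lambda>i. tree_val x rs (\<sigma> i)) p"
  by (cases p) auto

lemma outcome_unroll:
  assumes "steps M n (k, \<lambda>i. tree_val x rs (\<sigma> i)) = Some (k', z)" "M ! k' = Output" "n \<le> N"
    "\<And>i. wf_operand (length rs) (\<sigma> i)"
  shows "outcome x (unroll M N k \<sigma> (length rs)) rs = Some (z 1 \<noteq> 0)"
  using assms
proof (induction n arbitrary: k \<sigma> rs N)
  case 0
  then have "M ! k = Output" "z = (\<lambda>i. tree_val x rs (\<sigma> i))" by auto
  then show ?case using 0(4) by (cases N) (auto simp: outcome_zero_test)
next
  case (Suc n)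
  obtain N' where N: "N = Suc N'" "n \<le> N'" using Suc.prems(3) by (cases N) auto
  let ?z = "\<lambda>i. tree_val x rs (\<sigma> i)"
  have wf': "wf_operand (length (rs @ [r])) (\<sigma> i)" for r i
    using Suc.prems(4) by (rule wf_operand_mono) simp
  have ext: "tree_val x (rs @ [r]) (\<sigma> i) = tree_val x rs (\<sigma> i)" for r i
    using Suc.prems(4) by (rule tree_val_append)
  show ?case
  proof (cases "M ! k")
    case (MCompute i f p q k1)
    obtain r where r: "apply_op f (machine_val ?z p) (machine_val ?z q) = Some r"
      "steps M n (k1, ?z(i := r)) = Some (k', z)"
      using Suc.prems(1) MCompute by (auto split: option.splits)
    have "(\<lambda>j. tree_val x (rs @ [r]) ((\<sigma>(i := Result (length rs))) j)) = ?z(i := r)"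
      using ext by (auto simp: fun_eq_iff)
    then have "outcome x (unroll M N' k1 (\<sigma>(i := Result (length rs))) (length (rs @ [r]))) (rs @ [r])
        = Some (z 1 \<noteq> 0)"
      using r(2) N(2) Suc.prems(2) wf' by (intro Suc.IH) auto
    then show ?thesis using MCompute r(1) N(1) by (simp add: symbolic_val_correct)
  next
    case (MBranch i k1 l1)
    let ?r = "?z i"
    let ?k = "if ?r = 0 then k1 else l1"
    have "steps M n (?k, \<lambda>j. tree_val x (rs @ [?r]) (\<sigma> j)) = Some (k', z)"
      using Suc.prems(1) MBranch ext by simp
    then have "outcome x (unroll M N' ?k \<sigma> (length (rs @ [?r]))) (rs @ [?r]) = Some (z 1 \<noteq> 0)"
      using N(2) Suc.prems(2) wf' by (intro Suc.IH)
    then show ?thesis using MBranch N(1) Suc.prems(4)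
      by (auto simp: outcome_zero_test split: if_splits)
  next
    case (ShiftLeft k1)
    have "outcome x (unroll M N' k1 (\<lambda>i. \<sigma> (i + 1)) (length rs)) rs = Some (z 1 \<noteq> 0)"
      using Suc.prems ShiftLeft N(2) by (intro Suc.IH) auto
    then show ?thesis using ShiftLeft N(1) by simp
  next
    case (ShiftRight k1)
    have "outcome x (unroll M N' k1 (\<lambda>i. \<sigma> (i - 1)) (length rs)) rs = Some (z 1 \<noteq> 0)"
      using Suc.prems ShiftRight N(2) by (intro Suc.IH) auto
    then show ?thesis using ShiftRight N(1) by simp
  next
    case Output
    then show ?thesis using Suc.prems(1) by simp
  qed
qed

lemma machine_to_dtree:
  assumes "machine_decides_in_time M S T"
  shows "\<exists>t. dtree_decides_in_time t S (2 * T + 2)"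
proof -
  define \<sigma> where "\<sigma> = (\<lambda>i :: int. if i = 0 then TConst 1 else if i = 1 then Input else TConst 0)"
  define N where "N = nat \<lfloor>T\<rfloor>"
  define t where "t = unroll M N 0 \<sigma> 0"
  have wf: "wf_operand m (\<sigma> i)" for m i unfolding \<sigma>_def by auto
  have tape: "(\<lambda>i. tree_val x [] (\<sigma> i)) = input_tape x" for x
    unfolding \<sigma>_def input_tape_def by auto
  have "outcome x t [] = Some (x \<in> S)" for x
  proof -
    obtain n k z where n: "real n \<le> T" "steps M n (0, input_tape x) = Some (k, z)"
      "M ! k = Output" "z 1 = (if x \<in> S then 1 else 0)"
      using assms unfolding machine_decides_in_time_def by blast
    have "n \<le> N" using n(1) unfolding N_def by linarith
    then show ?thesis
      using outcome_unroll[of M n 0 x "[]" \<sigma> k z N] n wf unfolding t_def tape by simp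
  qed
  moreover have "wf_dtree 0 t" unfolding t_def using wf by (rule wf_unroll)
  moreover have "real (depth t) \<le> 2 * T + 2"
  proof -
    obtain n where "real n \<le> T" using assms unfolding machine_decides_in_time_def by blast
    then have "real N \<le> T" unfolding N_def by linarith
    moreover have "depth t \<le> 2 * N + 2" unfolding t_def by (rule depth_unroll)
    then have "real (depth t) \<le> 2 * real N + 2" by linarith
    ultimately show ?thesis by linarith
  qed
  ultimately show ?thesis unfolding dtree_decides_in_time_def by blast
qed

section \<open>The lower bound\<close>

text \<open>With \<open>\<tau> = depth t\<close>, \<open>D = 4 ^ \<tau>\<close> and \<open>r = 2 \<tau> + 2\<close>, one more than the number of generators (at most \<open>2 \<tau>\<close>
  constants and \<open>-1\<close>), the exponent bound satisfies \<open>E \<le> 2 ^ (8 \<tau> + 4)\<close>.\<close>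

lemma dtree_depth_lower_bound:
  assumes "dtree_decides_in_time t (X d) T"
  shows "d \<le> 8 * depth t + 5"
proof (rule ccontr)
  assume "\<not> d \<le> 8 * depth t + 5"
  then have d: "8 * depth t + 5 < d" by simp
  define \<tau> where "\<tau> = depth t"
  define D where "D = (4 :: nat) ^ \<tau>"
  define r where "r = 2 * \<tau> + 2"
  define q where "q = 2 * r"
  define E where "E = 2 * r * (D + 2) * D ^ 2"
  define x where "x i = (2 ^ (2 ^ (d * i)) :: complex)" for i
  have "X d = (\<lambda>i. 2 ^ (2 ^ (d * i))) ` {..d}" unfolding X_def by auto
  then have finX: "finite (X d)" by simp
  have xX: "x i \<in> X d" if "i < q" for i
    using that d unfolding X_def x_def q_def r_def \<tau>_def by auto
  obtain C F where F: "finite C" "card C \<le> 2 * \<tau>" "F \<noteq> 0"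
    "F \<in> small_sums (poly_generators C) D" "\<And>y. y \<in> X d \<Longrightarrow> poly F y = 0"
    using decided_finite_set_small_polynomial[of t "X d"] assms finX
    unfolding dtree_decides_in_time_def D_def \<tau>_def by blast
  define G where "G = insert (-1) C"
  have G: "finite G" "-1 \<in> G" "card G + 1 \<le> r"
    using F(1,2) card_insert_le_m1[of "2 * \<tau> + 1" C "-1"] unfolding G_def r_def
    by (auto simp: card_insert_if)
  have coeffs: "coeff F j \<in> small_sums G D" for j
    unfolding G_def by (rule coeff_degree_small_sums[OF F(4)])
  have degD: "degree F \<le> D" by (rule coeff_degree_small_sums[OF F(4)])
  have roots: "poly F (x i) = 0" if "i < q" for i
    using F(5) xX that by blast
  have deg0: "degree F > 0"
  proof (rule ccontr)
    assume "\<not> degree F > 0"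
    then obtain c where "F = [:c:]" using degree_eq_zeroE by blast
    then show False using roots[of 0] F(3) unfolding q_def r_def by auto
  qed
  have "E < 2 ^ d"
  proof -
    have le: "2 * r \<le> 4 ^ (\<tau> + 1)" "D + 2 \<le> 4 ^ (\<tau> + 1)"
    proof -
      have "\<tau> + 1 \<le> 4 ^ \<tau>" by (induction \<tau>) auto
      then show "2 * r \<le> 4 ^ (\<tau> + 1)" unfolding r_def by simp
      have "(1 :: nat) \<le> 4 ^ \<tau>" by simp
      then have "4 ^ \<tau> + 2 \<le> 4 * (4 ^ \<tau> :: nat)" by linarith
      then show "D + 2 \<le> 4 ^ (\<tau> + 1)"
        unfolding D_def by (simp only: Suc_eq_plus1[symmetric] power_Suc)
    qed
    have "E \<le> 4 ^ (\<tau> + 1) * 4 ^ (\<tau> + 1) * (4 ^ \<tau>) ^ 2"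
      unfolding E_def using le by (intro mult_mono) (auto simp: D_def)
    also have "\<dots> = 4 ^ (4 * \<tau> + 2)"
      by (simp add: power_add[symmetric] power_mult[symmetric])
    also have "\<dots> = 2 ^ (8 * \<tau> + 4)"
      by (simp add: power_mult power_add)
    also have "\<dots> < 2 ^ d"
      using d unfolding \<tau>_def by (intro power_strict_increasing) auto
    finally show ?thesis .
  qed
  then have inj: "inj_on (\<lambda>S. \<Sum>e\<in>S. \<Prod>i<q. x i ^ e i) (Pow ({..<q} \<rightarrow>\<^sub>E {..E}))"
    unfolding x_def by (rule subset_sums_of_iterated_powers_inj)
  have "(2 :: nat) ^ ((E + 1) ^ q) \<le>
      ((2 ^ (q * E * (D + 2)) + 1) ^ ((q * E * (D + 2) + 1) ^ card G)) ^ (degree F ^ q)"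
    by (rule subset_sums_of_monomials_bound[OF G(1,2) coeffs roots deg0 inj])
  moreover have "\<dots> < 2 ^ ((E + 1) ^ q)"
    unfolding E_def q_def
    by (rule reductions_fewer_than_subsets) (use G(3) degD in \<open>auto simp: D_def r_def\<close>)
  ultimately show False by simp
qed

theorem mainTheorem1:
  shows "\<not> (\<exists>a b :: real. a > 0 \<and> b > 0 \<and>
    (\<forall>d :: nat. d \<ge> 2 \<longrightarrow>
      (\<exists>M. machine_decides_in_time M (X d) (a * ln (real d) powr b)) \<or>
      (\<exists>t. dtree_decides_in_time t (X d) (a * ln (real d) powr b))))"
proof
  assume "\<exists>a b :: real. a > 0 \<and> b > 0 \<and>
    (\<forall>d :: nat. d \<ge> 2 \<longrightarrow>
      (\<exists>M. machine_decides_in_time M (X d) (a * ln (real d) powr b)) \<or>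
      (\<exists>t. dtree_decides_in_time t (X d) (a * ln (real d) powr b)))"
  then obtain a b :: real where ab: "a > 0" "b > 0" and
    dec: "\<And>d :: nat. d \<ge> 2 \<Longrightarrow>
      (\<exists>M. machine_decides_in_time M (X d) (a * ln (real d) powr b)) \<or>
      (\<exists>t. dtree_decides_in_time t (X d) (a * ln (real d) powr b))"
    by blast
  have "eventually (\<lambda>d :: nat. 8 * (2 * (a * ln (real d) powr b) + 2) + 5 < real d) at_top"
    using ab by real_asymp
  then obtain d :: nat where d: "d \<ge> 2"
    "8 * (2 * (a * ln (real d) powr b) + 2) + 5 < real d"
    using eventually_conj[OF _ eventually_ge_at_top[of "2 :: nat"]]
    by (metis (mono_tags, lifting) eventually_sequentially order_refl)
  define T where "T = a * ln (real d) powr b"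
  have "T \<ge> 0" unfolding T_def using ab by simp
  from dec[OF d(1)] have "\<exists>t. dtree_decides_in_time t (X d) (2 * T + 2)"
    unfolding T_def[symmetric]
  proof
    assume "\<exists>M. machine_decides_in_time M (X d) T"
    then show ?thesis using machine_to_dtree by blast
  next
    assume "\<exists>t. dtree_decides_in_time t (X d) T"
    then show ?thesis using \<open>T \<ge> 0\<close> unfolding dtree_decides_in_time_def by force
  qed
  then obtain t where t: "dtree_decides_in_time t (X d) (2 * T + 2)" by blast
  then have "real (depth t) \<le> 2 * T + 2" unfolding dtree_decides_in_time_def by blast
  moreover have "real d \<le> 8 * real (depth t) + 5"
    using dtree_depth_lower_bound[OF t] by linarith
  ultimately show False using d(2) unfolding T_def[symmetric] by argo
qed

end
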